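(* There exists a covering system of the integers such that all moduli are odd, square-free, greater than $1$, and pairwise distinct, except that $7$ is used exactly six times as a modulus.
   Context: A covering system of the integers is a finite collection of congruences $x\equiv r_j \pmod{m_j}$ such that every integer satisfies at least one of them. "$7$ is used exactly six times as a modulus" means exactly six congruences of the system have modulus $7$, while all other moduli are distinct from each other and from $7$. *)

theory Defs
  imports "HOL-Number_Theory.Cong" "HOL-Computational_Algebra.Squarefree"
begin

text \<open>
  A pair \<open>(r, m)\<close> stands for the congruence \<open>x \<equiv> r (mod m)\<close>. Residues are
  required to be reduced, so that distinct pairs are distinct congruences and counting
  pairs in a set counts congruences.
\<close>
definition covering_system :: "(int \<times> nat) set \<Rightarrow> bool" where
  "covering_system S \<longleftrightarrow>
     finite S \<and>
     (\<forall>(r, m) \<in> S. 0 < m \<and> 0 \<le> r \<and> r < int m) \<and>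
     (\<forall>x::int. \<exists>(r, m) \<in> S. [x = r] (mod int m))"

end

theory Submission
  imports Defs
begin

text \<open>
  A set \<open>P\<close> of primes encodes the squarefree modulus \<open>\<Prod>P\<close>, and by the Chinese remainder
  theorem a congruence modulo \<open>\<Prod>P\<close> is a choice of residues for the primes in \<open>P\<close>.
  Suppose every modulus may be used \<open>k\<close> times and \<open>p \<le> k + 1\<close>. Then copies of \<open>p\<close> cover all
  classes but \<open>0\<close> modulo \<open>p\<close>, and on that class each modulus \<open>d\<close> prime to \<open>p\<close> is available
  \<open>2k\<close> times, since \<open>d\<close> and \<open>d p\<close> have the same effect there. The six copies of \<open>7\<close>
  and then the primes \<open>3\<close> and \<open>5\<close> thus raise the multiplicity from \<open>1\<close> to \<open>2\<close>, \<open>4\<close> and \<open>8\<close>.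
  With multiplicity \<open>8\<close> an explicit covering exists using the primes \<open>11, 13, 17, 19\<close> only.
\<close>

text \<open>\<open>t i P p\<close> is the residue at \<open>p\<close> of copy \<open>i\<close> of
  the modulus encoded by \<open>P\<close>. Stating it prime by prime postpones the Chinese remainder
  theorem; a value outside \<open>0..<p\<close> gives a condition that no integer meets.\<close>

definition multicover :: "nat \<Rightarrow> nat set \<Rightarrow> bool" where
  "multicover k Q \<longleftrightarrow>
     (\<exists>t. \<forall>x::int. \<exists>i<k. \<exists>P\<subseteq>Q. P \<noteq> {} \<and> (\<forall>p\<in>P. x mod int p = t i P p))"

lemma multicover_insert:
  assumes "multicover (2 * k) Q" "p \<notin> Q" "0 < p" "p \<le> k + 1"
  shows "multicover k (insert p Q)"
proof -
  from assms(1) obtain t where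
    t: "\<And>x. \<exists>i<2*k. \<exists>P\<subseteq>Q. P \<noteq> {} \<and> (\<forall>q\<in>P. x mod int q = t i P q)"
    unfolding multicover_def by blast
  \<comment> \<open>Copy \<open>k + i\<close> of \<open>P\<close> is carried by copy
    \<open>i\<close> of \<open>insert p P\<close>, with residue \<open>0\<close> at
    \<open>p\<close>.\<close>
  define t' where "t' = (\<lambda>i P q.
    if P = {p} then int i + 1
    else if p \<notin> P then t i P q
    else if q = p then 0 else t (k + i) (P - {p}) q)"
  have "\<exists>i<k. \<exists>P\<subseteq>insert p Q. P \<noteq> {} \<and> (\<forall>q\<in>P. x mod int q = t' i P q)" for x
  proof (cases "x mod int p = 0")
    case False
    have "0 \<le> x mod int p" "x mod int p < int p"
      using \<open>0 < p\<close> by simp_all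
    with False \<open>p \<le> k + 1\<close> show ?thesis
      by (intro exI[of _ "nat (x mod int p - 1)"] conjI exI[of _ "{p}"])
         (auto simp: t'_def)
  next
    case True
    from t obtain i P where P: "i < 2 * k" "P \<subseteq> Q" "P \<noteq> {}"
      "\<And>q. q \<in> P \<Longrightarrow> x mod int q = t i P q"
      by metis
    have "p \<notin> P" "P \<noteq> {p}"
      using P(2) assms(2) by blast+
    show ?thesis
    proof (cases "i < k")
      case True
      with P \<open>p \<notin> P\<close> \<open>P \<noteq> {p}\<close> have "P \<subseteq> insert p Q" "\<forall>q\<in>P. x mod int q = t' i P q"
        by (auto simp: t'_def)
      with True P(3) show ?thesis
        by blast
    next
      case False
      have "insert p P \<noteq> {p}" "insert p P - {p} = P"
        using P(3) \<open>p \<notin> P\<close> by auto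
      with False \<open>x mod int p = 0\<close> \<open>p \<notin> P\<close> P
      have "i - k < k" "insert p P \<subseteq> insert p Q"
        "\<forall>q\<in>insert p P. x mod int q = t' (i - k) (insert p P) q"
        by (auto simp: t'_def)
      then show ?thesis
        by blast
    qed
  qed
  then show ?thesis
    unfolding multicover_def by blast
qed

text \<open>
  The residues from \<open>8\<close> on are left by the first eight copies of each prime. On them the products
  not involving \<open>19\<close> cover everything outside the class \<open>16\<close> modulo \<open>17\<close>, and, inside that
  class, everything with residue \<open>8\<close> modulo \<open>11\<close>.
\<close>
lemma multicover_8: "multicover 8 {11, 13, 17, 19}"
proof -
  \<comment> \<open>The final default gives each single prime the residues \<open>0\<close> to
    \<open>7\<close>. The copies of \<open>{11, 13}\<close>, and likewise those of
    \<open>{11, 19}\<close>, are shared between two classes modulo \<open>11\<close>.\<close>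
  define t :: "nat \<Rightarrow> nat set \<Rightarrow> nat \<Rightarrow> int" where "t = (\<lambda>i P.
    if P = {11, 13} then
      (if i < 5 then (\<lambda>_. 8 + int i)(11 := 8) else (\<lambda>_. 3 + int i)(11 := 9))
    else if P = {11, 17} then (\<lambda>_. 8 + int i)(11 := 10)
    else if P = {13, 17} then (\<lambda>_. 8 + int i)(13 := 11)
    else if P = {11, 13, 17} then (\<lambda>_. 8 + int i)(11 := 9, 13 := 12)
    else if P = {17, 19} then (\<lambda>_. 8 + int i)(17 := 16)
    else if P = {11, 19} then
      (if i < 3 then (\<lambda>_. 16 + int i)(11 := 9) else (\<lambda>_. 13 + int i)(11 := 10))
    else (\<lambda>_. int i))"
  have "\<exists>i<8. \<exists>P\<subseteq>{11, 13, 17, 19}. P \<noteq> {} \<and> (\<forall>p\<in>P. x mod int p = t i P p)" for x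
  proof -
    have C: ?thesis
      if "0 \<le> j" "j < 8" "P \<subseteq> {11, 13, 17, 19}" "P \<noteq> {}"
        "\<forall>p\<in>P. x mod int p = t (nat j) P p" for j P
      using that by (metis nat_less_iff of_nat_numeral)
    define a b c d where abcd: "a = x mod 11" "b = x mod 13" "c = x mod 17" "d = x mod 19"
    have bounds: "0 \<le> a" "a < 11" "0 \<le> b" "b < 13" "0 \<le> c" "c < 17" "0 \<le> d" "d < 19"
      by (simp_all add: abcd)
    \<comment> \<open>Once the cases with \<open>c < 16\<close> and \<open>a = 8\<close> are gone,
      \<open>c = 16\<close> and \<open>a\<close> is \<open>9\<close> or \<open>10\<close>. Then
      \<open>{17, 19}\<close> takes \<open>d\<close> from \<open>8\<close> to \<open>15\<close>, and
      the two shares of \<open>{11, 19}\<close> take \<open>d\<close> from \<open>16\<close> to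
      \<open>18\<close>.\<close>
    consider "a < 8" | "b < 8" | "c < 8" | "d < 8"
      | "a = 8" "8 \<le> b" | "a = 9" "8 \<le> b" "b < 11"
      | "a = 10" "8 \<le> c" "c < 16" | "b = 11" "8 \<le> c" "c < 16"
      | "a = 9" "b = 12" "8 \<le> c" "c < 16"
      | "c = 16" "8 \<le> d" "d < 16" | "a = 9" "16 \<le> d" | "a = 10" "16 \<le> d"
      using bounds by (smt (verit))
    then show ?thesis
    proof cases
      case 1
      show ?thesis
        by (rule C[of a "{11}"]) (use 1 bounds in \<open>auto simp: t_def abcd\<close>)
    next
      case 2
      show ?thesis
        by (rule C[of b "{13}"]) (use 2 bounds in \<open>auto simp: t_def abcd\<close>)
    next
      case 3
      show ?thesis
        by (rule C[of c "{17}"]) (use 3 bounds in \<open>auto simp: t_def abcd\<close>)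
    next
      case 4
      show ?thesis
        by (rule C[of d "{19}"]) (use 4 bounds in \<open>auto simp: t_def abcd\<close>)
    next
      case 5
      show ?thesis
        by (rule C[of "b - 8" "{11, 13}"]) (use 5 bounds in \<open>auto simp: t_def abcd\<close>)
    next
      case 6
      show ?thesis
        by (rule C[of "b - 3" "{11, 13}"]) (use 6 bounds in \<open>auto simp: t_def abcd\<close>)
    next
      case 7
      show ?thesis
        by (rule C[of "c - 8" "{11, 17}"]) (use 7 bounds in \<open>auto simp: t_def abcd insert_eq_iff\<close>)
    next
      case 8
      show ?thesis
        by (rule C[of "c - 8" "{13, 17}"]) (use 8 bounds in \<open>auto simp: t_def abcd insert_eq_iff\<close>)
    next
      case 9
      show ?thesis
        by (rule C[of "c - 8" "{11, 13, 17}"]) (use 9 bounds in \<open>auto simp: t_def abcd insert_eq_iff\<close>)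
    next
      case 10
      show ?thesis
        by (rule C[of "d - 8" "{17, 19}"]) (use 10 bounds in \<open>auto simp: t_def abcd insert_eq_iff\<close>)
    next
      case 11
      show ?thesis
        by (rule C[of "d - 16" "{11, 19}"]) (use 11 bounds in \<open>auto simp: t_def abcd insert_eq_iff\<close>)
    next
      case 12
      show ?thesis
        by (rule C[of "d - 13" "{11, 19}"]) (use 12 bounds in \<open>auto simp: t_def abcd insert_eq_iff\<close>)
    qed
  qed
  then show ?thesis
    unfolding multicover_def by blast
qed

text \<open>Primes are merged one at a time by the Chinese remainder theorem for two coprime
  moduli.\<close>

lemma prod_primes_crt:
  fixes P :: "nat set" and t :: "nat \<Rightarrow> int"
  assumes "finite P" "\<And>p. p \<in> P \<Longrightarrow> prime p"
  shows "\<exists>r. \<forall>x. (\<forall>p\<in>P. x mod int p = t p) \<longrightarrow> [x = r] (mod int (\<Prod>P))"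
  using assms
proof (induction P rule: finite_induct)
  case empty
  show ?case by simp
next
  case (insert p P)
  then obtain r where r: "\<And>x. (\<forall>q\<in>P. x mod int q = t q) \<Longrightarrow> [x = r] (mod int (\<Prod>P))"
    by auto
  have "coprime p (\<Prod>P)"
    using insert by (intro prod_coprime_right primes_coprime) auto
  then have coprime: "coprime (int p) (int (\<Prod>P))"
    by (simp only: coprime_int_iff)
  then obtain s where s: "[s = t p] (mod int p)" "[s = r] (mod int (\<Prod>P))"
    using binary_chinese_remainder_int by blast
  have "[x = s] (mod int p * int (\<Prod>P))" if "\<forall>q\<in>insert p P. x mod int q = t q" for x
  proof (rule coprime_cong_mult[OF _ _ coprime])
    show "[x = s] (mod int p)"
      using that s(1) by (metis cong_mod_left cong_sym insertCI)
    show "[x = s] (mod int (\<Prod>P))"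
      using that r s(2) cong_trans cong_sym by (metis insertCI)
  qed
  then show ?case
    using insert(1,2) by auto
qed

text \<open>The set is recovered as the prime factors of its product. This makes the moduli
  distinct.\<close>

lemma inj_on_prod_primes:
  "inj_on (\<lambda>P. \<Prod>P) {P :: nat set. finite P \<and> (\<forall>p\<in>P. prime p)}"
proof (rule inj_on_inverseI)
  fix P :: "nat set"
  assume "P \<in> {P. finite P \<and> (\<forall>p\<in>P. prime p)}"
  then have "finite P" "\<forall>p\<in>P. prime p" "0 \<notin> P"
    by auto
  then show "prime_factors (\<Prod>P) = P"
    using prime_factors_prod[of P "\<lambda>p. p"] by (auto simp: prime_prime_factors)
qed

theorem theorem3p4:
  "\<exists>S :: (int \<times> nat) set.
     covering_system S \<and>
     (\<forall>(r, m) \<in> S. odd m \<and> squarefree m \<and> 1 < m) \<and>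
     card {c \<in> S. snd c = 7} = 6 \<and>
     inj_on snd {c \<in> S. snd c \<noteq> 7}"
proof -
  define Q :: "nat set" where "Q = {3, 5, 11, 13, 17, 19}"
  \<comment> \<open>The bound \<open>p \<le> k + 1\<close> is attained both times:
    \<open>5 = 4 + 1\<close> here, then \<open>3 = 2 + 1\<close>.\<close>
  have "multicover 4 {5, 11, 13, 17, 19}"
    by (rule multicover_insert) (simp_all add: multicover_8)
  then have "multicover 2 Q"
    unfolding Q_def by - (rule multicover_insert, simp_all)
  then obtain t where
    t: "\<And>x. \<exists>i<2::nat. \<exists>P\<subseteq>Q. P \<noteq> {} \<and> (\<forall>p\<in>P. x mod int p = t i P p)"
    unfolding multicover_def by blast
  \<comment> \<open>The doubling is repeated by hand for \<open>7\<close>, which gets six copies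
    while every other modulus gets one.\<close>
  define t' where "t' = (\<lambda>P q.
    if 7 \<notin> P then t 0 P q else if q = 7 then 0 else t 1 (P - {7}) q)"
  define \<M> where "\<M> = Pow (insert 7 Q) - {{}, {7}}"
  have "finite Q"
    by (simp add: Q_def)
  have prime_Q: "prime p" "odd p" if "p \<in> insert 7 Q" for p
    using that by (auto simp: Q_def)
  have \<M>: "finite P" "P \<noteq> {}" "\<And>p. p \<in> P \<Longrightarrow> prime p" "\<And>p. p \<in> P \<Longrightarrow> odd p"
    if "P \<in> \<M>" for P
  proof -
    have P: "P \<subseteq> insert 7 Q" "P \<noteq> {}"
      using that by (simp_all add: \<M>_def)
    with \<open>finite Q\<close> show "finite P" "P \<noteq> {}"
      by (auto dest: finite_subset)
    show "prime p" "odd p" if "p \<in> P" for p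
      using prime_Q P(1) that by blast+
  qed
  have "\<forall>P\<in>\<M>. \<exists>r. \<forall>x. (\<forall>p\<in>P. x mod int p = t' P p) \<longrightarrow> [x = r] (mod int (\<Prod>P))"
    using \<M> by (intro ballI prod_primes_crt) auto
  then obtain r where
    r: "\<And>P x. P \<in> \<M> \<Longrightarrow> \<forall>p\<in>P. x mod int p = t' P p \<Longrightarrow> [x = r P] (mod int (\<Prod>P))"
    by metis
  have cover: "\<exists>P\<in>\<M>. [x = r P] (mod int (\<Prod>P))" if "x mod 7 = 0" for x
  proof -
    obtain i P where P: "i < 2" "P \<subseteq> Q" "P \<noteq> {}" "\<forall>p\<in>P. x mod int p = t i P p"
      using t by metis
    have "7 \<notin> P"
      using P(2) by (auto simp: Q_def)
    show ?thesis
    proof (cases "i = 0")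
      case True
      with P \<open>7 \<notin> P\<close> have "P \<in> \<M>" "\<forall>p\<in>P. x mod int p = t' P p"
        by (auto simp: \<M>_def t'_def)
      then show ?thesis
        using r by blast
    next
      case False
      with P(1) have "i = 1" by simp
      have "insert 7 P - {7} = P" "insert 7 P \<noteq> {7}"
        using \<open>7 \<notin> P\<close> P(3) by auto
      with P \<open>i = 1\<close> that have "insert 7 P \<in> \<M>" "\<forall>p\<in>insert 7 P. x mod int p = t' (insert 7 P) p"
        by (auto simp: \<M>_def t'_def)
      then show ?thesis
        using r by blast
    qed
  qed
  define A where "A = (\<lambda>a. (a :: int, 7 :: nat)) ` {1..6}"
  define B where "B = (\<lambda>P. (r P mod int (\<Prod>P), \<Prod>P)) ` \<M>"
  have gt_1: "1 < \<Prod>P" if "P \<in> \<M>" for P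
  proof -
    note P = \<M>[OF that]
    obtain p where "p \<in> P"
      using P(2) by blast
    moreover have "0 < \<Prod>P"
      using P(3) by (intro prod_pos) (auto intro: prime_gt_0_nat)
    ultimately have "p \<le> \<Prod>P"
      using P(1) dvd_prodI[of P p "\<lambda>p. p"] by (auto intro: dvd_imp_le)
    then show ?thesis
      using prime_gt_1_nat[OF P(3)[OF \<open>p \<in> P\<close>]] by simp
  qed
  have odd_sqf: "odd (\<Prod>P)" "squarefree (\<Prod>P)" if "P \<in> \<M>" for P
  proof -
    note P = \<M>[OF that]
    show "odd (\<Prod>P)"
      using P(1,4) prime_dvd_prod_iff[of P 2 "\<lambda>p. p"] by auto
    show "squarefree (\<Prod>P)"
      by (rule squarefree_prod_coprime) (use P(3) in \<open>simp_all add: squarefree_prime primes_coprime\<close>)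
  qed
  \<comment> \<open>Including \<open>{7}\<close> also shows that no other modulus equals
    \<open>7\<close>.\<close>
  have inj: "inj_on (\<lambda>P. \<Prod>P) (insert {7} \<M>)"
    by (rule inj_on_subset[OF inj_on_prod_primes]) (use \<M> in auto)
  have neq_7: "\<Prod>P \<noteq> 7" if "P \<in> \<M>" for P
    using inj_onD[OF inj, of P "{7}"] that by (auto simp: \<M>_def)
  have AB: "{c \<in> A \<union> B. snd c = 7} = A" "{c \<in> A \<union> B. snd c \<noteq> 7} = B"
    using neq_7 by (auto simp: A_def B_def)
  have "covering_system (A \<union> B)"
    unfolding covering_system_def
  proof (intro conjI allI)
    show "finite (A \<union> B)"
      using \<open>finite Q\<close> by (simp add: A_def B_def \<M>_def)
    show "\<forall>(r, m)\<in>A \<union> B. 0 < m \<and> 0 \<le> r \<and> r < int m"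
      using gt_1 by (fastforce simp: A_def B_def simp del: of_nat_prod)
    show "\<exists>(r, m)\<in>A \<union> B. [x = r] (mod int m)" for x
    proof (cases "x mod 7 = 0")
      case True
      then obtain P where "P \<in> \<M>" "[x = r P] (mod int (\<Prod>P))"
        using cover[OF True] by auto
      then show ?thesis
        by (intro bexI[of _ "(r P mod int (\<Prod>P), \<Prod>P)"]) (auto simp: B_def cong_def)
    next
      case False
      then have "1 \<le> x mod 7" "x mod 7 \<le> 6"
        by presburger+
      then have "(x mod 7, 7) \<in> A"
        by (auto simp: A_def)
      then show ?thesis
        by (intro bexI[of _ "(x mod 7, 7)"]) (auto simp: cong_def)
    qed
  qed
  moreover have "\<forall>(r, m)\<in>A \<union> B. odd m \<and> squarefree m \<and> 1 < m"
    using gt_1 odd_sqf squarefree_prime[of "7 :: nat"] by (auto simp: A_def B_def)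
  moreover have "card A = 6"
    unfolding A_def by (subst card_image) (auto simp: inj_on_def)
  moreover have "inj_on snd B"
    using inj by (auto simp: B_def inj_on_def)
  ultimately show ?thesis
    using AB by (intro exI[of _ "A \<union> B"]) simp
qed

end
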